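(* Any bi-freely max-infinitely divisible bivariate distribution function is max-infinitely divisible.
   Context: A bivariate distribution function is $F(x_1,x_2)=\mu((-\infty,x_1]\times(-\infty,x_2])$ for a Borel probability measure $\mu$ on $\mathbb{R}^2$; $F_1,F_2$ denote its marginal distribution functions. $c_+=\max\{c,0\}$. Bi-free max-convolution: for bivariate distribution functions $F,G$, $H=F\star G$ is the (unique) bivariate distribution function with marginals $H_j=(F_j+G_j-1)_+$ on $\mathbb{R}$, $j=1,2$, and such that $\frac{H_1H_2}{H}=\frac{F_1F_2}{F}+\frac{G_1G_2}{G}-1$ at each $\mathbf{x}$ where $F(\mathbf{x}),G(\mathbf{x}),H_1(x_1),H_2(x_2)$ are all strictly positive, and $H(\mathbf{x})=0$ at all other $\mathbf{x}$. The operation is well defined, commutative and associative; $F^{\star n}$ is the $n$-fold convolution of $F$ with itself. $F$ is bi-freely max-infinitely divisible if for every $n\in\mathbb{N}$ there is a bivariate distribution function $F^{(1/n)}$ with $(F^{(1/n)})^{\star n}=F$. A bivariate distribution function $G$ is max-infinitely divisible (in the classical sense) if the pointwise power $G^{1/n}$ is a bivariate distribution function for every $n\in\mathbb{N}$. *)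

theory Defs
  imports "HOL-Probability.Probability"
begin

definition bivariate_cdf_of :: "(real \<times> real) measure \<Rightarrow> (real \<Rightarrow> real \<Rightarrow> real) \<Rightarrow> bool" where
  "bivariate_cdf_of M F \<longleftrightarrow> prob_space M \<and> sets M = sets borel \<and>
     (\<forall>x y. F x y = measure M ({..x} \<times> {..y}))"

definition bivariate_cdf :: "(real \<Rightarrow> real \<Rightarrow> real) \<Rightarrow> bool" where
  "bivariate_cdf F \<longleftrightarrow> (\<exists>M. bivariate_cdf_of M F)"

(* The marginals are recovered from F alone; the two lemmas below identify them with the
   distribution functions of the marginal measures. *)

definition marginal1 :: "(real \<Rightarrow> real \<Rightarrow> real) \<Rightarrow> real \<Rightarrow> real" where
  "marginal1 F x = Lim at_top (\<lambda>y. F x y)"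

definition marginal2 :: "(real \<Rightarrow> real \<Rightarrow> real) \<Rightarrow> real \<Rightarrow> real" where
  "marginal2 F y = Lim at_top (\<lambda>x. F x y)"

lemma marginal1_eq_cdf:
  assumes "bivariate_cdf_of M F"
  shows "marginal1 F x = cdf (distr M borel fst) x"
proof -
  from assms interpret prob_space M by (simp add: bivariate_cdf_of_def)
  have s[measurable_cong]: "sets M = sets (borel \<Otimes>\<^sub>M borel)"
    and F: "\<And>x y. F x y = measure M ({..x} \<times> {..y})"
    using assms unfolding bivariate_cdf_of_def borel_prod by blast+
  have sp: "space M = UNIV" using sets_eq_imp_space_eq[OF s] by (simp add: space_pair_measure)
  have f[measurable]: "fst \<in> borel_measurable M" and g[measurable]: "snd \<in> borel_measurable M"
    by measurable
  define N where "N = restrict_space M (fst -` {..x})"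
  have m: "fst -` {..x} \<in> sets M" using measurable_sets[OF f, of "{..x}"] sp by simp
  have N: "finite_measure N" unfolding N_def using m
    by (intro finite_measure_restrict_space) (auto simp: sp finite_measure_axioms)
  interpret D: finite_borel_measure "distr N borel snd"
    unfolding finite_borel_measure_def finite_borel_measure_axioms_def
    by (intro conjI finite_measure.finite_measure_distr[OF N])
      (auto simp: N_def intro!: measurable_restrict_space1)
  have sn: "space N = fst -` {..x}" by (simp add: N_def space_restrict_space sp)
  have mN: "snd \<in> borel_measurable N" by (auto simp: N_def intro!: measurable_restrict_space1)
  have "cdf (distr N borel snd) = F x"
  proof
    fix y :: real
    have "snd -` {..y} \<inter> fst -` {..x} = {..x} \<times> {..y}" by auto
    moreover have "measure N ({..x} \<times> {..y}) = measure M ({..x} \<times> {..y})"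
      unfolding N_def by (rule measure_restrict_space) (use m sp in auto)
    ultimately show "cdf (distr N borel snd) y = F x y" unfolding cdf_def F
      by (subst measure_distr[OF mN]) (simp_all add: sn)
  qed
  moreover have "measure (distr N borel snd) (space (distr N borel snd)) = cdf (distr M borel fst) x"
    unfolding cdf_def
    by (subst measure_distr[OF mN], simp, subst measure_distr[OF f], simp)
      (auto simp: sn N_def measure_restrict_space m sp)
  ultimately have "(F x \<longlongrightarrow> cdf (distr M borel fst) x) at_top"
    using D.cdf_lim_at_top by simp
  then show ?thesis unfolding marginal1_def by (intro tendsto_Lim) auto
qed

lemma marginal2_eq_cdf:
  assumes "bivariate_cdf_of M F"
  shows "marginal2 F y = cdf (distr M borel snd) y"
proof -
  let ?N = "distr M borel (\<lambda>(a, b). (b, a))" and ?G = "\<lambda>y x. F x y"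
  interpret prob_space M using assms by (simp add: bivariate_cdf_of_def)
  have s: "sets M = sets (borel \<Otimes>\<^sub>M borel)"
    and F: "\<And>x y. F x y = measure M ({..x} \<times> {..y})"
    using assms unfolding bivariate_cdf_of_def borel_prod by blast+
  have sp: "space M = UNIV" using sets_eq_imp_space_eq[OF s] by (simp add: space_pair_measure)
  have sw: "(\<lambda>(a, b). (b, a)) \<in> measurable M (borel :: (real \<times> real) measure)"
    unfolding borel_prod[symmetric] using s by measurable
  have "bivariate_cdf_of ?N ?G" unfolding bivariate_cdf_of_def
  proof (intro conjI allI)
    show "prob_space ?N" by (rule prob_space_distr[OF sw])
    show "F x y = measure ?N ({..y} \<times> {..x})" for x y
    proof -
      have "(\<lambda>(a, b). (b, a)) -` ({..y} \<times> {..x}) = {..x} \<times> {..y}" by auto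
      then show ?thesis
        by (subst measure_distr[OF sw]) (auto simp: F sp borel_prod[symmetric])
    qed
  qed simp
  from marginal1_eq_cdf[OF this, of y] have "marginal2 F y = cdf (distr ?N borel fst) y"
    by (simp add: marginal1_def marginal2_def)
  also have "distr ?N borel fst = distr M borel snd"
    by (subst distr_distr[OF _ sw])
      (auto simp: borel_prod[symmetric] comp_def case_prod_beta)
  finally show ?thesis .
qed

(* "H is the bi-free max-convolution of F and G."  In the third clause the right-hand side is at
   least F_1 + G_1 - 1 = H_1 > 0, so H x y = 0 is excluded there although x / 0 = 0. *)

definition is_bifree_max_conv ::
  "(real \<Rightarrow> real \<Rightarrow> real) \<Rightarrow> (real \<Rightarrow> real \<Rightarrow> real) \<Rightarrow> (real \<Rightarrow> real \<Rightarrow> real) \<Rightarrow> bool" where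
  "is_bifree_max_conv F G H \<longleftrightarrow>
     bivariate_cdf H \<and>
     (\<forall>x. marginal1 H x = max (marginal1 F x + marginal1 G x - 1) 0) \<and>
     (\<forall>y. marginal2 H y = max (marginal2 F y + marginal2 G y - 1) 0) \<and>
     (\<forall>x y. if F x y > 0 \<and> G x y > 0 \<and> marginal1 H x > 0 \<and> marginal2 H y > 0
        then marginal1 H x * marginal2 H y / H x y =
               marginal1 F x * marginal2 F y / F x y + marginal1 G x * marginal2 G y / G x y - 1
        else H x y = 0)"

lemma is_bifree_max_conv_unique:
  assumes H: "is_bifree_max_conv F G H" and K: "is_bifree_max_conv F G K"
  shows "H = K"
proof (intro ext)
  fix x y
  have m: "marginal1 K x = marginal1 H x" "marginal2 K y = marginal2 H y"
    using H K by (simp_all add: is_bifree_max_conv_def)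
  show "H x y = K x y"
  proof (cases "F x y > 0 \<and> G x y > 0 \<and> marginal1 H x > 0 \<and> marginal2 H y > 0")
    case True
    then have "marginal1 H x * marginal2 H y / H x y = marginal1 H x * marginal2 H y / K x y"
      using H K m unfolding is_bifree_max_conv_def by metis
    moreover have "marginal1 H x * marginal2 H y \<noteq> 0" using True by auto
    ultimately show ?thesis by (simp add: divide_inverse)
  next
    case False
    then show ?thesis using H K m unfolding is_bifree_max_conv_def by metis
  qed
qed

(* "H is the n-fold bi-free max-convolution of F with itself", for n at least 1. *)

inductive is_bifree_max_power ::
  "(real \<Rightarrow> real \<Rightarrow> real) \<Rightarrow> nat \<Rightarrow> (real \<Rightarrow> real \<Rightarrow> real) \<Rightarrow> bool" for F where
  one: "is_bifree_max_power F 1 F"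
| step: "is_bifree_max_power F n H \<Longrightarrow> is_bifree_max_conv H F K \<Longrightarrow> is_bifree_max_power F (Suc n) K"

definition bifree_max_inf_divisible :: "(real \<Rightarrow> real \<Rightarrow> real) \<Rightarrow> bool" where
  "bifree_max_inf_divisible F \<longleftrightarrow>
     (\<forall>n\<ge>1. \<exists>G. bivariate_cdf G \<and> is_bifree_max_power G n F)"

definition max_inf_divisible :: "(real \<Rightarrow> real \<Rightarrow> real) \<Rightarrow> bool" where
  "max_inf_divisible G \<longleftrightarrow>
     (\<forall>n::nat. n \<ge> 1 \<longrightarrow> bivariate_cdf (\<lambda>x y. G x y powr (1 / real n)))"

end

theory Submission
  imports Defs
begin

text \<open>Write \<open>F\<^sub>1\<close>, \<open>F\<^sub>2\<close> for the marginals of \<open>F\<close> and \<open>K = F\<^sub>1F\<^sub>2/F\<close>. Both the deficits \<open>1 - F\<^sub>j\<close> (as long as \<open>F\<^sub>j\<close> is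
positive) and the quantity \<open>K - 1\<close> are additive under bi-free max-convolution. So an \<open>n\<close>-th root \<open>G\<close> of \<open>F\<close>
is known explicitly where \<open>F\<close> is positive, and \<open>n (1 - G)\<close> tends to
\<open>(1 - F\<^sub>1) + (1 - F\<^sub>2) + (K - 1)\<close>. Each root is a distribution function and therefore gives nonnegative
mass to rectangles. In the limit, the terms depending on one coordinate cancel, and \<open>- K\<close> has nonnegative
rectangle increments; unbounded rectangles show in the same way that \<open>K\<close> is nondecreasing in each argument
(\<open>bifree_max_inf_divisible_ratio_mono\<close>). For four numbers of which the upper right one is the largest, the
inequality between the sums over the two diagonals passes to products, so that
\<open>F b c * F a d \<le> F a c * F b d\<close> for \<open>a \<le> b\<close> and \<open>c \<le> d\<close>: the function \<open>F\<close> is totally positive of order two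
(\<open>bifree_max_inf_divisible_TP2\<close>).

This property suffices for classical max-infinite divisibility. It is preserved by powers with
positive exponent, and for a function that is nondecreasing in both arguments it implies the rectangle
inequality (\<open>rectangle_powr_of_TP2\<close>). Continuity from the right and the limits at infinity pass to powers
trivially. It remains to know that a function with these properties is the distribution function of a
measure on the plane (\<open>bivariate_cdfI\<close>). The measure is obtained as the law of a pair of random
variables. The first one has the law of the marginal; the second one is a conditional quantile, built from
an independent uniform variable and the Radon-Nikodym densities of the horizontal sections with respect to the
marginal.\<close>

section \<open>Dominated finite measures on the line\<close>

text \<open>If the difference of two distribution functions is nondecreasing, then it is itself the distribution
function of a finite measure \<open>D\<close>, and the larger measure is the smaller one plus \<open>D\<close>, because finite
Borel measures are determined by their distribution functions.\<close>

lemma emeasure_le_if_mono_cdf_diff: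
  assumes M: "finite_borel_measure M" and N: "finite_borel_measure N"
    and mono: "\<And>x y. x \<le> y \<Longrightarrow> cdf N x - cdf M x \<le> cdf N y - cdf M y"
    and B: "B \<in> sets borel"
  shows "emeasure M B \<le> emeasure N B"
proof -
  interpret M: finite_borel_measure M by (rule M)
  interpret N: finite_borel_measure N by (rule N)
  have [measurable_cong]: "sets M = sets borel" and sN: "sets N = sets borel"
    by (rule M.M_is_borel N.M_is_borel)+
  define \<phi> where "\<phi> = (\<lambda>x. cdf N x - cdf M x)"
  define D where "D = interval_measure \<phi>"
  have mono_\<phi>: "x \<le> y \<Longrightarrow> \<phi> x \<le> \<phi> y" for x y using mono by (simp add: \<phi>_def)
  have rc: "continuous (at_right a) \<phi>" for a
    unfolding \<phi>_def by (intro continuous_diff M.cdf_is_right_cont N.cdf_is_right_cont)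
  have bot: "(\<phi> \<longlongrightarrow> 0) at_bot"
    unfolding \<phi>_def using tendsto_diff[OF N.cdf_lim_at_bot M.cdf_lim_at_bot] by simp
  have top: "(\<phi> \<longlongrightarrow> measure N (space N) - measure M (space M)) at_top"
    unfolding \<phi>_def by (intro tendsto_diff M.cdf_lim_at_top N.cdf_lim_at_top)
  have nonneg: "0 \<le> \<phi> x" for x
    using bot by (rule tendsto_upperbound)
      (auto simp: eventually_at_bot_linorder mono_\<phi> intro!: exI[of _ x])
  have "0 \<le> measure N (space N) - measure M (space M)"
    using top by (rule tendsto_lowerbound) (auto simp: nonneg)
  then interpret D: finite_borel_measure D
    unfolding D_def by (intro finite_borel_measure_interval_measure[OF mono_\<phi> rc bot top])
  have cdf_D: "cdf D = \<phi>"
    unfolding D_def by (rule cdf_interval_measure[OF mono_\<phi> rc bot])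
  have sD: "sets D = sets borel" by (rule D.M_is_borel)
  \<comment> \<open>\<open>S\<close> is the sum of the measures \<open>M\<close> and \<open>D\<close>.\<close>
  define S where "S = measure_of UNIV (sets borel) (\<lambda>B. emeasure M B + emeasure D B)"
  have sS: "sets S = sets borel"
    unfolding S_def using sets.sigma_sets_eq[of borel] by (simp add: sets_measure_of_conv)
  have S: "emeasure S B = emeasure M B + emeasure D B" if "B \<in> sets borel" for B
  proof (rule emeasure_measure_of[OF S_def])
    show "positive (sets S) (\<lambda>B. emeasure M B + emeasure D B)" by (simp add: positive_def)
    show "countably_additive (sets S) (\<lambda>B. emeasure M B + emeasure D B)"
      unfolding countably_additive_def
    proof (intro allI impI)
      fix E :: "nat \<Rightarrow> real set"
      assume E: "range E \<subseteq> sets S" "disjoint_family E" "\<Union> (range E) \<in> sets S"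
      have "(\<Sum>i. emeasure M (E i) + emeasure D (E i)) =
          (\<Sum>i. emeasure M (E i)) + (\<Sum>i. emeasure D (E i))"
        by (intro suminf_add[symmetric]) auto
      then show "(\<Sum>i. emeasure M (E i) + emeasure D (E i)) =
          emeasure M (\<Union> (range E)) + emeasure D (\<Union> (range E))"
        using E by (simp add: suminf_emeasure sS sD M.M_is_borel)
    qed
  qed (use that sS in auto)
  have "emeasure S (space S) \<noteq> \<infinity>"
    using sets_eq_imp_space_eq[OF sS] S[of UNIV] by (simp add: less_top[symmetric])
  then have "finite_borel_measure S"
    unfolding finite_borel_measure_def finite_borel_measure_axioms_def
    using sS by (intro conjI finite_measureI)
  moreover have "cdf S x = cdf N x" for x
  proof -
    have "measure S {..x} = measure M {..x} + measure D {..x}"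
      unfolding measure_def using S[of "{..x}"] by (simp add: enn2real_plus less_top[symmetric])
    then show ?thesis using cdf_D by (simp add: cdf_def \<phi>_def fun_eq_iff)
  qed
  ultimately have "S = N" by (intro cdf_unique' N) auto
  then show ?thesis using S[OF B] by simp
qed

lemma AE_le_if_density_le:
  assumes [measurable]: "f \<in> borel_measurable M" "g \<in> borel_measurable M"
    and fin: "(\<integral>\<^sup>+x. g x \<partial>M) \<noteq> \<infinity>"
    and le: "\<And>B. B \<in> sets M \<Longrightarrow> emeasure (density M f) B \<le> emeasure (density M g) B"
  shows "AE x in M. f x \<le> g x"
proof (rule ccontr)
  assume *: "\<not> ?thesis"
  define B where "B = {x \<in> space M. g x < f x}"
  have [measurable]: "B \<in> sets M" by (simp add: B_def)
  have "(\<integral>\<^sup>+x. g x * indicator B x \<partial>M) < (\<integral>\<^sup>+x. f x * indicator B x \<partial>M)"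
  proof (rule nn_integral_less)
    have "(\<integral>\<^sup>+x. g x * indicator B x \<partial>M) \<le> (\<integral>\<^sup>+x. g x \<partial>M)"
      by (intro nn_integral_mono) (auto split: split_indicator)
    then show "(\<integral>\<^sup>+x. g x * indicator B x \<partial>M) \<noteq> \<infinity>" using fin by (auto simp: top_unique)
    show "AE x in M. g x * indicator B x \<le> f x * indicator B x"
      by (intro AE_I2) (auto simp: B_def split: split_indicator)
    show "\<not> (AE x in M. f x * indicator B x \<le> g x * indicator B x)"
    proof
      assume "AE x in M. f x * indicator B x \<le> g x * indicator B x"
      then have "AE x in M. f x \<le> g x"
        by (rule AE_mp) (auto simp: B_def not_less intro!: AE_I2 split: split_indicator_asm)
      with * show False by blast
    qed
  qed auto
  then show False using le[of B] by (simp add: emeasure_density not_less[symmetric])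
qed

section \<open>Construction of bivariate distribution functions\<close>

text \<open>Realises an increasing family of measures below \<open>\<mu>\<close> by one increasing family of events. The densities
\<open>f q\<close> of \<open>N q\<close> with respect to \<open>\<mu>\<close> lie almost everywhere in the unit interval, so if \<open>u\<close> is uniform
and independent of a \<open>\<mu>\<close>-distributed \<open>x\<close>, the event \<open>u < f q x\<close> has conditional probability \<open>f q x\<close>
given \<open>x\<close>. The same \<open>u\<close> serves for every \<open>q\<close>, which makes the events nested. Nesting
holds only up to null sets, since each density is determined only up to a null set.\<close>

lemma nested_events_of_dominated_measures:
  fixes N :: "real \<Rightarrow> real measure"
  assumes \<mu>: "real_distribution \<mu>" and N: "\<And>q. finite_borel_measure (N q)"
    and N_le: "\<And>q B. B \<in> sets borel \<Longrightarrow> emeasure (N q) B \<le> emeasure \<mu> B"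
    and N_mono: "\<And>q r B. q \<le> r \<Longrightarrow> B \<in> sets borel \<Longrightarrow> emeasure (N q) B \<le> emeasure (N r) B"
  obtains P :: "(real \<times> real) measure" and A :: "real \<Rightarrow> (real \<times> real) set"
  where "prob_space P" "sets P = sets borel" "\<And>q. A q \<in> sets P"
    "\<And>q r. q \<le> r \<Longrightarrow> AE \<omega> in P. \<omega> \<in> A q \<longrightarrow> \<omega> \<in> A r"
    "\<And>q B. B \<in> sets borel \<Longrightarrow> measure P {\<omega> \<in> A q. fst \<omega> \<in> B} = measure (N q) B"
proof -
  interpret \<mu>: real_distribution \<mu> by (rule \<mu>)
  have s\<mu>: "sets \<mu> = sets borel" by simp
  have sN: "sets (N q) = sets \<mu>" for q using finite_borel_measure.M_is_borel[OF N] by simp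
  define U where "U = uniform_measure lborel {0..1::real}"
  interpret U: prob_space U unfolding U_def by (intro prob_space_uniform_measure) auto
  have sU: "sets U = sets borel" by (simp add: U_def)
  interpret P: pair_prob_space \<mu> U ..
  define f where "f q = RN_deriv \<mu> (N q)" for q
  have f[measurable]: "f q \<in> borel_measurable borel" for q
    using borel_measurable_RN_deriv[of \<mu> "N q"] by (simp add: f_def measurable_def)
  have "absolutely_continuous \<mu> (N q)" for q
    unfolding absolutely_continuous_def null_sets_def
    using N_le[of _ q] sN by auto (metis le_zero_eq)
  then have dens: "density \<mu> (f q) = N q" for q
    unfolding f_def by (intro \<mu>.density_RN_deriv sN)
  have fin: "(\<integral>\<^sup>+x. f q x \<partial>\<mu>) \<noteq> \<infinity>" for q
  proof -
    have "(\<integral>\<^sup>+x. f q x \<partial>\<mu>) = emeasure (density \<mu> (f q)) (space \<mu>)"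
      by (subst emeasure_density) (auto simp: indicator_def)
    also have "\<dots> \<noteq> \<infinity>"
      unfolding dens using finite_borel_measure.axioms(1)[OF N[of q]]
      by (simp add: finite_measure.emeasure_finite)
    finally show ?thesis .
  qed
  have f_mono: "AE x in \<mu>. f q x \<le> f r x" if "q \<le> r" for q r
    using N_mono[OF that] fin by (intro AE_le_if_density_le) (auto simp: dens)
  have f_le_1: "AE x in \<mu>. f q x \<le> 1" for q
    using N_le by (intro AE_le_if_density_le) (auto simp: dens density_1 \<mu>.emeasure_space_1)
  have U_less: "emeasure U {u. ennreal u < c} = c" if "c \<le> 1" for c
  proof -
    define r where "r = enn2real c"
    have r: "c = ennreal r" "0 \<le> r" "r \<le> 1"
      using that le_less_trans[OF that, of \<top>] by (auto simp: r_def intro!: enn2real_leI)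
    have "{0..1} \<inter> {u. ennreal u < c} = {0..<r}"
      using r by (auto simp: ennreal_less_iff)
    then show ?thesis unfolding U_def using r by (simp add: divide_ennreal_def)
  qed
  define A where "A q = {(x, u). ennreal u < f q x}" for q
  have A[measurable]: "A q \<in> sets (borel \<Otimes>\<^sub>M borel)" for q
  proof -
    have "A q = {\<omega> \<in> space (borel \<Otimes>\<^sub>M borel). ennreal (snd \<omega>) < f q (fst \<omega>)}"
      by (auto simp: A_def space_pair_measure)
    also have "\<dots> \<in> sets (borel \<Otimes>\<^sub>M borel)" by measurable
    finally show ?thesis .
  qed
  have sP: "sets (\<mu> \<Otimes>\<^sub>M U) = sets (borel \<Otimes>\<^sub>M borel)"
    by (intro sets_pair_measure_cong s\<mu> sU)
  show ?thesis
  proof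
    show "prob_space (\<mu> \<Otimes>\<^sub>M U)" by (rule P.prob_space_axioms)
    show "sets (\<mu> \<Otimes>\<^sub>M U) = sets borel" by (simp only: sP borel_prod)
    show "A q \<in> sets (\<mu> \<Otimes>\<^sub>M U)" for q using sP A by simp
    show "AE \<omega> in \<mu> \<Otimes>\<^sub>M U. \<omega> \<in> A q \<longrightarrow> \<omega> \<in> A r" if "q \<le> r" for q r
    proof (rule P.AE_pair_measure)
      have "{x \<in> space (\<mu> \<Otimes>\<^sub>M U). x \<in> A q \<longrightarrow> x \<in> A r} = (space (\<mu> \<Otimes>\<^sub>M U) - A q) \<union> A r"
        using sP A[of r] sets.sets_into_space by blast
      also have "\<dots> \<in> sets (\<mu> \<Otimes>\<^sub>M U)"
        by (intro sets.Un sets.Diff sets.top) (simp_all only: sP A)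
      finally show "{x \<in> space (\<mu> \<Otimes>\<^sub>M U). x \<in> A q \<longrightarrow> x \<in> A r} \<in> sets (\<mu> \<Otimes>\<^sub>M U)" .
      show "AE x in \<mu>. AE y in U. (x, y) \<in> A q \<longrightarrow> (x, y) \<in> A r"
        using f_mono[OF that] by eventually_elim (auto simp: A_def)
    qed
    show "measure (\<mu> \<Otimes>\<^sub>M U) {\<omega> \<in> A q. fst \<omega> \<in> B} = measure (N q) B" if B: "B \<in> sets borel" for q B
    proof -
      have "{\<omega> \<in> A q. fst \<omega> \<in> B} = A q \<inter> (B \<times> UNIV)" by auto
      moreover have "A q \<inter> (B \<times> UNIV) \<in> sets (\<mu> \<Otimes>\<^sub>M U)"
        unfolding sP using B by auto
      ultimately have "emeasure (\<mu> \<Otimes>\<^sub>M U) {\<omega> \<in> A q. fst \<omega> \<in> B} =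
          (\<integral>\<^sup>+x. emeasure U (Pair x -` (A q \<inter> (B \<times> UNIV))) \<partial>\<mu>)"
        by (simp add: U.emeasure_pair_measure_alt)
      also have "\<dots> = (\<integral>\<^sup>+x. f q x * indicator B x \<partial>\<mu>)"
      proof (intro nn_integral_cong_AE)
        show "AE x in \<mu>. emeasure U (Pair x -` (A q \<inter> (B \<times> UNIV))) = f q x * indicator B x"
          using f_le_1[of q] by eventually_elim (auto simp: A_def vimage_def U_less split: split_indicator)
      qed
      also have "\<dots> = emeasure (N q) B"
        using B by (subst dens[symmetric]) (simp add: emeasure_density)
      finally show ?thesis by (simp add: measure_def)
    qed
  qed
qed

text \<open>The events \<open>A q\<close> play the role of the events \<open>Y \<le> q\<close> for a random variable \<open>Y\<close> yet to be found. The
infimum of all \<open>q\<close> whose event occurs is such a variable; only rational \<open>q\<close> are used, so that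
the infimum is measurable and the null sets stay countable in number. It is taken in the extended
reals; the limits of \<open>H\<close> in its second argument, and that of \<open>h\<close>, show that infinite values have
probability zero.\<close>

lemma quantile_of_nested_events:
  fixes H :: "real \<Rightarrow> real \<Rightarrow> real" and X :: "'a \<Rightarrow> real"
  assumes P: "prob_space P" and X[measurable]: "X \<in> borel_measurable P"
    and A[measurable]: "\<And>q. A q \<in> sets P"
    and nested: "\<And>q r. q \<le> r \<Longrightarrow> AE \<omega> in P. \<omega> \<in> A q \<longrightarrow> \<omega> \<in> A r"
    and P_A: "\<And>x q. measure P {\<omega> \<in> A q. X \<omega> \<le> x} = H x q"
    and rc: "\<And>x y. continuous (at_right y) (H x)"
    and bot: "\<And>x. (H x \<longlongrightarrow> 0) at_bot"
    and top1: "\<And>x. (H x \<longlongrightarrow> h x) at_top" and top2: "(h \<longlongrightarrow> 1) at_top"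
  obtains Y where "Y \<in> borel_measurable P"
    "\<And>x y. measure P {\<omega> \<in> space P. X \<omega> \<le> x \<and> Y \<omega> \<le> y} = H x y"
proof -
  interpret prob_space P by (rule P)
  define Z :: "'a \<Rightarrow> ereal" where "Z \<omega> = (INF q\<in>\<rat>. if \<omega> \<in> A q then ereal q else \<infinity>)" for \<omega>
  have Z[measurable]: "Z \<in> borel_measurable P"
    unfolding Z_def by (intro borel_measurable_INF) (auto simp: countable_rat)
  have Z_le: "Z \<omega> \<le> ereal q" if "q \<in> \<rat>" "\<omega> \<in> A q" for \<omega> q
    unfolding Z_def using that by (intro INF_lower2[of q]) auto
  have Z_gt: "AE \<omega> in P. Z \<omega> < ereal q \<longrightarrow> \<omega> \<in> A q" for q
  proof -
    have "AE \<omega> in P. \<forall>r\<in>{r \<in> \<rat>. r \<le> q}. \<omega> \<in> A r \<longrightarrow> \<omega> \<in> A q"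
      using nested by (subst AE_ball_countable) (auto intro: countable_subset[OF _ countable_rat])
    then show ?thesis
    proof eventually_elim
      case (elim \<omega>)
      show ?case
      proof
        assume "Z \<omega> < ereal q"
        then obtain r where "r \<in> \<rat>" "(if \<omega> \<in> A r then ereal r else \<infinity>) < ereal q"
          unfolding Z_def INF_less_iff by blast
        with elim show "\<omega> \<in> A q" by (auto split: if_splits)
      qed
    qed
  qed
  define G where "G x y = measure P {\<omega> \<in> space P. X \<omega> \<le> x \<and> Z \<omega> \<le> ereal y}" for x y
  have A_sub: "A q \<subseteq> space P" for q using A by (rule sets.sets_into_space)
  have G_mono: "G x y \<le> G x z" if "y \<le> z" for x y z
    unfolding G_def by (intro finite_measure_mono) (auto intro: order_trans[OF _ ereal_less_eq(3)[THEN iffD2, OF that]])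
  have G_ge: "H x q \<le> G x q" if "q \<in> \<rat>" for x q
    unfolding G_def P_A[symmetric] using A_sub Z_le that by (intro finite_measure_mono) auto
  have G_le: "G x y \<le> H x q" if "y < q" for x y q
    unfolding G_def P_A[symmetric]
  proof (intro finite_measure_mono_AE)
    show "AE \<omega> in P. \<omega> \<in> {\<omega> \<in> space P. X \<omega> \<le> x \<and> Z \<omega> \<le> ereal y} \<longrightarrow> \<omega> \<in> {\<omega> \<in> A q. X \<omega> \<le> x}"
      using Z_gt[of q] by eventually_elim (auto intro: le_less_trans simp: that)
  qed measurable
  have H_mono: "H x q \<le> H x r" if "q \<le> r" for x q r
    unfolding P_A[symmetric]
  proof (intro finite_measure_mono_AE)
    show "AE \<omega> in P. \<omega> \<in> {\<omega> \<in> A q. X \<omega> \<le> x} \<longrightarrow> \<omega> \<in> {\<omega> \<in> A r. X \<omega> \<le> x}"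
      using nested[OF that] by eventually_elim auto
  qed measurable
  have G_eq: "G x y = H x y" for x y
  proof (rule antisym)
    have lim: "(H x \<longlongrightarrow> H x y) (at_right y)" using rc by (simp add: continuous_within)
    show "G x y \<le> H x y"
      using lim by (rule tendsto_lowerbound) (auto simp: eventually_at_filter G_le)
    \<comment> \<open>The lower bound \<open>H x q \<le> G x q\<close> holds for rational \<open>q\<close>; continuity from above carries it to \<open>y\<close>.\<close>
    define d where "d n = y + 1 / real (Suc n)" for n
    have "(\<lambda>n. measure P {\<omega> \<in> space P. X \<omega> \<le> x \<and> Z \<omega> \<le> ereal (d n)}) \<longlonglongrightarrow>
        measure P (\<Inter>n. {\<omega> \<in> space P. X \<omega> \<le> x \<and> Z \<omega> \<le> ereal (d n)})"
    proof (intro finite_Lim_measure_decseq)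
      show "decseq (\<lambda>n. {\<omega> \<in> space P. X \<omega> \<le> x \<and> Z \<omega> \<le> ereal (d n)})"
        by (auto simp: decseq_def d_def elim!: order_trans intro!: frac_le)
    qed auto
    moreover have "(\<Inter>n. {\<omega> \<in> space P. X \<omega> \<le> x \<and> Z \<omega> \<le> ereal (d n)}) =
        {\<omega> \<in> space P. X \<omega> \<le> x \<and> Z \<omega> \<le> ereal y}" (is "?L = ?R")
    proof
      show "?R \<subseteq> ?L" by (auto simp: d_def elim!: order_trans)
      have dl: "(\<lambda>n. ereal (d n)) \<longlonglongrightarrow> ereal (y + 0)"
        unfolding d_def by (intro tendsto_intros LIMSEQ_Suc lim_1_over_n)
      show "?L \<subseteq> ?R"
        using tendsto_lowerbound[OF dl, of "Z _"] by (auto intro!: always_eventually)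
    qed
    ultimately have "(\<lambda>n. G x (d n)) \<longlonglongrightarrow> G x y" by (simp add: G_def)
    moreover have "H x y \<le> G x (d n)" for n
    proof -
      obtain q where q: "q \<in> \<rat>" "y < q" "q < d n"
        using Rats_dense_in_real[of y "d n"] by (auto simp: d_def)
      then show ?thesis using H_mono[of y q x] G_ge[of q x] G_mono[of q "d n" x] by simp
    qed
    ultimately show "H x y \<le> G x y" by (intro LIMSEQ_le_const) auto
  qed
  have "AE \<omega> in P. Z \<omega> \<noteq> -\<infinity>"
  proof -
    have "AE \<omega> in P. \<not> (X \<omega> \<le> real n \<and> Z \<omega> = -\<infinity>)" for n
    proof -
      have "measure P {\<omega> \<in> space P. X \<omega> \<le> real n \<and> Z \<omega> = -\<infinity>} \<le> G (real n) y" for y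
        unfolding G_def by (intro finite_measure_mono) auto
      then have "measure P {\<omega> \<in> space P. X \<omega> \<le> real n \<and> Z \<omega> = -\<infinity>} \<le> 0"
        using bot[of "real n"] by (intro tendsto_lowerbound[OF bot[of "real n"]]) (auto simp: G_eq)
      then show ?thesis
        by (subst AE_iff_measurable[OF _ refl]) (auto simp: emeasure_eq_measure measure_le_0_iff)
    qed
    then have "AE \<omega> in P. \<forall>n. \<not> (X \<omega> \<le> real n \<and> Z \<omega> = -\<infinity>)"
      unfolding AE_all_countable by blast
    then show ?thesis by eventually_elim (use real_arch_simple in blast)
  qed
  moreover have "AE \<omega> in P. Z \<omega> \<noteq> \<infinity>"
  proof -
    have *: "H x y \<le> prob {\<omega> \<in> space P. Z \<omega> \<noteq> \<infinity>}" for x y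
      unfolding G_eq[symmetric] G_def by (intro finite_measure_mono) auto
    have "h x \<le> prob {\<omega> \<in> space P. Z \<omega> \<noteq> \<infinity>}" for x
      using top1 by (rule tendsto_upperbound) (auto simp: *)
    then have "1 \<le> prob {\<omega> \<in> space P. Z \<omega> \<noteq> \<infinity>}"
      by (intro tendsto_upperbound[OF top2]) auto
    then have "prob {\<omega> \<in> space P. Z \<omega> \<noteq> \<infinity>} = 1" by (intro antisym) auto
    then show ?thesis by (subst (asm) prob_Collect_eq_1) auto
  qed
  ultimately have fin: "AE \<omega> in P. ereal (real_of_ereal (Z \<omega>)) = Z \<omega>"
    by eventually_elim (auto simp: ereal_real)
  show ?thesis
  proof
    show "(\<lambda>\<omega>. real_of_ereal (Z \<omega>)) \<in> borel_measurable P" by measurable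
    show "measure P {\<omega> \<in> space P. X \<omega> \<le> x \<and> real_of_ereal (Z \<omega>) \<le> y} = H x y" for x y
      unfolding G_eq[symmetric] G_def
    proof (intro finite_measure_eq_AE)
      show "AE \<omega> in P. (\<omega> \<in> {\<omega> \<in> space P. X \<omega> \<le> x \<and> real_of_ereal (Z \<omega>) \<le> y}) =
          (\<omega> \<in> {\<omega> \<in> space P. X \<omega> \<le> x \<and> Z \<omega> \<le> ereal y})"
        using fin by eventually_elim (metis (mono_tags, lifting) ereal_less_eq(3) mem_Collect_eq)
    qed measurable
  qed
qed


text \<open>For each \<open>q\<close>, the section of \<open>H\<close> at height \<open>q\<close> is the distribution function of a finite measure on
the line. The rectangle inequality says that these measures increase with \<open>q\<close> and, after letting the
upper edge of the rectangle go to infinity, that the marginal \<open>h1\<close> dominates all of them. Such a family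
gives nested events and hence a second coordinate, so that \<open>H\<close> is the joint distribution function of
two random variables.\<close>

theorem bivariate_cdfI:
  fixes H :: "real \<Rightarrow> real \<Rightarrow> real"
  assumes rect: "\<And>a b c d. a \<le> b \<Longrightarrow> c \<le> d \<Longrightarrow> H b c + H a d \<le> H a c + H b d"
    and rc1: "\<And>x y. continuous (at_right x) (\<lambda>x. H x y)"
    and rc2: "\<And>x y. continuous (at_right y) (H x)"
    and bot1: "\<And>y. ((\<lambda>x. H x y) \<longlongrightarrow> 0) at_bot"
    and bot2: "\<And>x. (H x \<longlongrightarrow> 0) at_bot"
    and top1: "\<And>y. ((\<lambda>x. H x y) \<longlongrightarrow> h2 y) at_top"
    and top2: "\<And>x. (H x \<longlongrightarrow> h1 x) at_top"
    and rc_h1: "\<And>x. continuous (at_right x) h1"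
    and bot_h1: "(h1 \<longlongrightarrow> 0) at_bot" and top_h1: "(h1 \<longlongrightarrow> 1) at_top"
  shows "bivariate_cdf H"
proof -
  have mono: "H a y \<le> H b y" if "a \<le> b" for a b y
  proof -
    have "((\<lambda>c. H b c + H a y - H a c) \<longlongrightarrow> 0 + H a y - 0) at_bot"
      by (intro tendsto_intros bot2)
    then have "0 + H a y - 0 \<le> H b y"
      by (rule tendsto_upperbound)
        (use rect[OF that] in \<open>auto simp: eventually_at_bot_linorder algebra_simps intro!: exI[of _ y]\<close>)
    then show ?thesis by simp
  qed
  have nonneg: "0 \<le> H x y" for x y
    using bot1 by (rule tendsto_upperbound)
      (auto simp: eventually_at_bot_linorder intro!: mono exI[of _ x])
  have h2_nonneg: "0 \<le> h2 y" for y
    using top1 by (rule tendsto_lowerbound) (auto simp: nonneg)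
  have h1_diff: "h1 x - H x q \<le> h1 y - H y q" if "x \<le> y" for x y q
  proof -
    have "((\<lambda>d. H y d - H x d) \<longlongrightarrow> h1 y - h1 x) at_top"
      by (intro tendsto_intros top2)
    then have "H y q - H x q \<le> h1 y - h1 x"
      by (rule tendsto_lowerbound)
        (use rect[OF that] in \<open>auto simp: eventually_at_top_linorder algebra_simps intro!: exI[of _ q]\<close>)
    then show ?thesis by simp
  qed
  have mono_h1: "h1 x \<le> h1 y" if "x \<le> y" for x y
    using h1_diff[OF that] mono[OF that] by (smt (verit))
  define \<mu> where "\<mu> = interval_measure h1"
  define N where "N q = interval_measure (\<lambda>x. H x q)" for q
  have \<mu>: "real_distribution \<mu>" and cdf_\<mu>: "cdf \<mu> = h1"
    unfolding \<mu>_def using mono_h1 rc_h1 bot_h1 top_h1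
    by (auto intro!: real_distribution_interval_measure cdf_interval_measure)
  have N: "finite_borel_measure (N q)" and cdf_N: "cdf (N q) = (\<lambda>x. H x q)" for q
    unfolding N_def using finite_borel_measure_interval_measure[OF _ rc1 bot1 top1 h2_nonneg] rc1 bot1
    by (auto intro!: cdf_interval_measure simp: mono)
  have N_le: "emeasure (N q) B \<le> emeasure \<mu> B" if "B \<in> sets borel" for q B
    using that real_distribution.finite_borel_measure_M[OF \<mu>]
    by (intro emeasure_le_if_mono_cdf_diff N) (auto simp: cdf_N cdf_\<mu> h1_diff)
  have N_mono: "emeasure (N q) B \<le> emeasure (N r) B" if "q \<le> r" "B \<in> sets borel" for q r B
    using that rect by (intro emeasure_le_if_mono_cdf_diff N) (auto simp: cdf_N algebra_simps)
  show ?thesis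
  proof (rule nested_events_of_dominated_measures[OF \<mu> N N_le N_mono])
    fix P :: "(real \<times> real) measure" and A :: "real \<Rightarrow> (real \<times> real) set"
    assume PA: "prob_space P" "sets P = sets borel" "\<And>q. A q \<in> sets P"
        "\<And>q r. q \<le> r \<Longrightarrow> AE \<omega> in P. \<omega> \<in> A q \<longrightarrow> \<omega> \<in> A r"
      and P_A: "\<And>q B. B \<in> sets borel \<Longrightarrow> measure P {\<omega> \<in> A q. fst \<omega> \<in> B} = measure (N q) B"
    have [measurable_cong]: "sets P = sets (borel \<Otimes>\<^sub>M borel)" by (simp only: PA(2) borel_prod)
    have [measurable]: "fst \<in> borel_measurable P" by measurable
    have P_A_Iic: "measure P {\<omega> \<in> A q. fst \<omega> \<le> x} = H x q" for x q
      using P_A[of "{..x}" q] fun_cong[OF cdf_N, of q x] by (simp add: cdf_def)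
    obtain Y where Y[measurable]: "Y \<in> borel_measurable P"
      and P_Y: "\<And>x y. measure P {\<omega> \<in> space P. fst \<omega> \<le> x \<and> Y \<omega> \<le> y} = H x y"
      using quantile_of_nested_events[OF PA(1) _ PA(3,4) P_A_Iic rc2 bot2 top2 top_h1] by auto
    have XY: "(\<lambda>\<omega>. (fst \<omega>, Y \<omega>)) \<in> measurable P borel"
      unfolding borel_prod[symmetric] by measurable
    have "bivariate_cdf_of (distr P borel (\<lambda>\<omega>. (fst \<omega>, Y \<omega>))) H"
      unfolding bivariate_cdf_of_def
    proof (intro conjI allI)
      show "prob_space (distr P borel (\<lambda>\<omega>. (fst \<omega>, Y \<omega>)))"
        by (rule prob_space.prob_space_distr[OF PA(1) XY])
      show "H x y = measure (distr P borel (\<lambda>\<omega>. (fst \<omega>, Y \<omega>))) ({..x} \<times> {..y})" for x y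
        unfolding P_Y[symmetric]
        by (subst measure_distr[OF XY]) (auto simp: borel_prod[symmetric] intro!: arg_cong[where f="measure P"])
    qed simp
    then show "bivariate_cdf H" by (auto simp: bivariate_cdf_def)
  qed
qed

section \<open>Sections and marginals of bivariate distribution functions\<close>

lemma bivariate_cdf_swap:
  assumes "bivariate_cdf F"
  shows "bivariate_cdf (\<lambda>x y. F y x)"
proof -
  obtain M where M: "bivariate_cdf_of M F" using assms by (auto simp: bivariate_cdf_def)
  then interpret prob_space M by (simp add: bivariate_cdf_of_def)
  have F: "F x y = measure M ({..x} \<times> {..y})" for x y using M by (simp add: bivariate_cdf_of_def)
  have [measurable_cong]: "sets M = sets (borel \<Otimes>\<^sub>M borel)"
    using M unfolding bivariate_cdf_of_def borel_prod by blast
  have sw: "prod.swap \<in> measurable M borel"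
    unfolding borel_prod[symmetric] prod.swap_def[abs_def] by measurable
  have sp: "space M = UNIV"
    using M sets_eq_imp_space_eq[of M borel] by (simp add: bivariate_cdf_of_def)
  have "bivariate_cdf_of (distr M borel prod.swap) (\<lambda>x y. F y x)"
    unfolding bivariate_cdf_of_def
  proof (intro conjI allI)
    show "prob_space (distr M borel prod.swap)" by (rule prob_space_distr[OF sw])
    show "F y x = measure (distr M borel prod.swap) ({..x} \<times> {..y})" for x y
      unfolding F by (subst measure_distr[OF sw])
        (auto simp: sp borel_prod[symmetric] intro!: arg_cong[where f="measure M"])
  qed simp
  then show ?thesis by (auto simp: bivariate_cdf_def)
qed

lemma marginal_swap:
  "marginal1 (\<lambda>x y. F y x) = marginal2 F" "marginal2 (\<lambda>x y. F y x) = marginal1 F"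
  by (simp_all add: marginal1_def marginal2_def fun_eq_iff)

lemma bivariate_cdf_section:
  assumes "bivariate_cdf F"
  obtains N where "finite_borel_measure N" "cdf N = F x"
proof -
  obtain M where M: "bivariate_cdf_of M F" using assms by (auto simp: bivariate_cdf_def)
  then interpret prob_space M by (simp add: bivariate_cdf_of_def)
  have F: "F x y = measure M ({..x} \<times> {..y})" for x y using M by (simp add: bivariate_cdf_of_def)
  have s[measurable_cong]: "sets M = sets (borel \<Otimes>\<^sub>M borel)"
    using M unfolding bivariate_cdf_of_def borel_prod by blast
  have sp: "space M = UNIV"
    using M sets_eq_imp_space_eq[of M borel] by (simp add: bivariate_cdf_of_def)
  define R where "R = restrict_space M ({..x} \<times> UNIV)"
  have R: "{..x} \<times> UNIV \<in> sets M" unfolding s by auto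
  interpret R: finite_measure R unfolding R_def using R
    by (intro finite_measure_restrict_space) (auto simp: finite_measure_axioms)
  have spR: "space R = {..x} \<times> UNIV" by (simp add: R_def space_restrict_space sp)
  have mR: "snd \<in> borel_measurable R"
    unfolding R_def by (intro measurable_restrict_space1) measurable
  show ?thesis
  proof
    show "finite_borel_measure (distr R borel snd)"
      unfolding finite_borel_measure_def finite_borel_measure_axioms_def
      by (intro conjI R.finite_measure_distr mR) simp
    show "cdf (distr R borel snd) = F x"
    proof
      fix y
      have "snd -` {..y} \<inter> space R = {..x} \<times> {..y}" using spR by auto
      then have "cdf (distr R borel snd) y = measure R ({..x} \<times> {..y})"
        unfolding cdf_def by (simp add: measure_distr[OF mR])
      also have "\<dots> = F x y"
        unfolding F R_def by (rule measure_restrict_space) (use R sp in auto)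
      finally show "cdf (distr R borel snd) y = F x y" .
    qed
  qed
qed

lemma bivariate_cdf_real_distribution_marginal1:
  assumes "bivariate_cdf F"
  obtains \<mu> where "real_distribution \<mu>" "cdf \<mu> = marginal1 F"
proof -
  obtain M where M: "bivariate_cdf_of M F" using assms by (auto simp: bivariate_cdf_def)
  then interpret prob_space M by (simp add: bivariate_cdf_of_def)
  have [measurable_cong]: "sets M = sets (borel \<Otimes>\<^sub>M borel)"
    using M unfolding bivariate_cdf_of_def borel_prod by blast
  have "random_variable borel (fst :: real \<times> real \<Rightarrow> real)" by measurable
  then have "real_distribution (distr M borel fst)" by (rule real_distribution_distr)
  moreover have "cdf (distr M borel fst) = marginal1 F"
    using marginal1_eq_cdf[OF M] by auto
  ultimately show ?thesis by (rule that)
qed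

lemma
  assumes "bivariate_cdf F"
  shows bivariate_cdf_nonneg: "0 \<le> F x y"
    and bivariate_cdf_mono2: "y \<le> y' \<Longrightarrow> F x y \<le> F x y'"
    and bivariate_cdf_right_cont2: "continuous (at_right y) (F x)"
    and bivariate_cdf_at_bot2: "(F x \<longlongrightarrow> 0) at_bot"
    and bivariate_cdf_at_top2: "(F x \<longlongrightarrow> marginal1 F x) at_top"
    and bivariate_cdf_le_marginal1: "F x y \<le> marginal1 F x"
proof -
  obtain N where N: "finite_borel_measure N" "cdf N = F x"
    using bivariate_cdf_section[OF assms] .
  then interpret N: finite_borel_measure N by simp
  show "0 \<le> F x y" "y \<le> y' \<Longrightarrow> F x y \<le> F x y'" "continuous (at_right y) (F x)"
      "(F x \<longlongrightarrow> 0) at_bot"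
    using N.cdf_nonneg[of y] N.cdf_nondecreasing[of y y'] N.cdf_is_right_cont[of y] N.cdf_lim_at_bot N(2)
    by simp_all
  have lim: "(F x \<longlongrightarrow> measure N (space N)) at_top" using N.cdf_lim_at_top N(2) by simp
  then have m: "marginal1 F x = measure N (space N)"
    unfolding marginal1_def by (intro tendsto_Lim) auto
  with lim show "(F x \<longlongrightarrow> marginal1 F x) at_top" by simp
  show "F x y \<le> marginal1 F x" using N.cdf_bounded[of y] N(2) m by simp
qed

lemmas bivariate_cdf_mono1 = bivariate_cdf_mono2[OF bivariate_cdf_swap]
lemmas bivariate_cdf_right_cont1 = bivariate_cdf_right_cont2[OF bivariate_cdf_swap]
lemmas bivariate_cdf_at_bot1 = bivariate_cdf_at_bot2[OF bivariate_cdf_swap]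
lemmas bivariate_cdf_at_top1 = bivariate_cdf_at_top2[OF bivariate_cdf_swap, unfolded marginal_swap(1)]
lemmas bivariate_cdf_le_marginal2 =
  bivariate_cdf_le_marginal1[OF bivariate_cdf_swap, unfolded marginal_swap(1)]

lemma
  assumes "bivariate_cdf F"
  shows marginal1_le_1: "marginal1 F x \<le> 1"
    and marginal1_right_cont: "continuous (at_right x) (marginal1 F)"
    and marginal1_at_bot: "(marginal1 F \<longlongrightarrow> 0) at_bot"
    and marginal1_at_top: "(marginal1 F \<longlongrightarrow> 1) at_top"
    and marginal1_nonneg: "0 \<le> marginal1 F x"
proof -
  obtain \<mu> where \<mu>: "real_distribution \<mu>" "cdf \<mu> = marginal1 F"
    using bivariate_cdf_real_distribution_marginal1[OF assms] .
  then interpret \<mu>: real_distribution \<mu> by simp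
  show "marginal1 F x \<le> 1" "continuous (at_right x) (marginal1 F)" "(marginal1 F \<longlongrightarrow> 0) at_bot"
    "(marginal1 F \<longlongrightarrow> 1) at_top" "0 \<le> marginal1 F x"
    using \<mu>.cdf_bounded_prob[of x] \<mu>.cdf_is_right_cont[of x] \<mu>.cdf_lim_at_bot
      \<mu>.cdf_lim_at_top_prob \<mu>.cdf_nonneg[of x] \<mu>(2) by simp_all
qed

lemmas marginal2_le_1 = marginal1_le_1[OF bivariate_cdf_swap, unfolded marginal_swap(1)]
lemmas marginal2_nonneg = marginal1_nonneg[OF bivariate_cdf_swap, unfolded marginal_swap(1)]

lemma bivariate_cdf_rectangle:
  assumes "bivariate_cdf F" and le: "a \<le> b" "c \<le> d"
  shows "F b c + F a d \<le> F a c + F b d"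
proof -
  obtain M where M: "bivariate_cdf_of M F" using assms by (auto simp: bivariate_cdf_def)
  then interpret prob_space M by (simp add: bivariate_cdf_of_def)
  have F: "F x y = measure M ({..x} \<times> {..y})" for x y using M by (simp add: bivariate_cdf_of_def)
  have s: "sets M = sets (borel \<Otimes>\<^sub>M borel)"
    using M unfolding bivariate_cdf_of_def borel_prod by blast
  have [measurable]: "{..x} \<times> {..y} \<in> sets M" for x y :: real unfolding s by auto
  have "F b c + F a d = prob ({..b} \<times> {..c} \<union> {..a} \<times> {..d}) + prob ({..b} \<times> {..c} \<inter> {..a} \<times> {..d})"
    unfolding F by (subst measure_Un3) (auto simp: fmeasurable_eq_sets)
  also have "{..b} \<times> {..c} \<inter> {..a} \<times> {..d} = {..a} \<times> {..c}" using le by auto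
  also have "prob ({..b} \<times> {..c} \<union> {..a} \<times> {..d}) \<le> prob ({..b} \<times> {..d})"
    using le by (intro finite_measure_mono) auto
  finally show ?thesis by (simp add: F)
qed

text \<open>The rectangle inequality for a rectangle that is unbounded above.\<close>

lemma bivariate_cdf_rectangle_at_top:
  assumes F: "bivariate_cdf F" and le: "a \<le> b"
  shows "marginal1 F a - F a c \<le> marginal1 F b - F b c"
proof -
  have "((\<lambda>d. F b d - F a d) \<longlongrightarrow> marginal1 F b - marginal1 F a) at_top"
    by (intro tendsto_intros bivariate_cdf_at_top2[OF F])
  then have "F b c - F a c \<le> marginal1 F b - marginal1 F a"
    by (rule tendsto_lowerbound)
      (use bivariate_cdf_rectangle[OF F le, of c] in
        \<open>auto simp: eventually_at_top_linorder algebra_simps intro!: exI[of _ c]\<close>)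
  then show ?thesis by simp
qed

section \<open>Bi-free max-convolution powers\<close>

lemma is_bifree_max_conv_swap:
  assumes "is_bifree_max_conv F G H"
  shows "is_bifree_max_conv (\<lambda>x y. F y x) (\<lambda>x y. G y x) (\<lambda>x y. H y x)"
  using assms bivariate_cdf_swap[of H]
  by (auto simp: is_bifree_max_conv_def marginal_swap[of F] marginal_swap[of G] marginal_swap[of H] mult.commute split: if_splits)

lemma is_bifree_max_power_swap:
  "is_bifree_max_power G n F \<Longrightarrow> is_bifree_max_power (\<lambda>x y. G y x) n (\<lambda>x y. F y x)"
  by (induction rule: is_bifree_max_power.induct)
    (blast intro: is_bifree_max_power.intros is_bifree_max_conv_swap)+

lemma bifree_max_power_bivariate_cdf:
  assumes "is_bifree_max_power G n F" "bivariate_cdf G"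
  shows "bivariate_cdf F"
  using assms by (cases rule: is_bifree_max_power.cases) (auto simp: is_bifree_max_conv_def)

lemma bifree_max_power_marginal1:
  assumes "is_bifree_max_power G n F" "bivariate_cdf G"
  shows "marginal1 F x = max (1 - real n * (1 - marginal1 G x)) 0"
  using assms
proof (induction rule: is_bifree_max_power.induct)
  case one
  then show ?case using marginal1_nonneg[of G x] by simp
next
  case (step n H K)
  then have "marginal1 K x = max (marginal1 H x + marginal1 G x - 1) 0"
    by (simp add: is_bifree_max_conv_def)
  then show ?case using step marginal1_le_1[of G x] by (auto simp: max_def algebra_simps)
qed

lemmas bifree_max_power_marginal2 =
  bifree_max_power_marginal1[OF is_bifree_max_power_swap bivariate_cdf_swap, unfolded marginal_swap(1)]

text \<open>The convolution formula says that the quantity \<open>F\<^sub>1F\<^sub>2/F - 1\<close> is additive under bi-free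
max-convolution wherever the result is positive.\<close>

lemma bifree_max_power_ratio:
  assumes "is_bifree_max_power G n F" "bivariate_cdf G" "F x y > 0"
  shows "G x y > 0"
    and "marginal1 F x * marginal2 F y / F x y - 1 = real n * (marginal1 G x * marginal2 G y / G x y - 1)"
proof -
  have "G x y > 0 \<and> marginal1 F x * marginal2 F y / F x y - 1 =
      real n * (marginal1 G x * marginal2 G y / G x y - 1)"
    using assms
  proof (induction rule: is_bifree_max_power.induct)
    case (step n H K)
    then have pos: "H x y > 0" "G x y > 0"
      and K: "marginal1 K x * marginal2 K y / K x y =
        marginal1 H x * marginal2 H y / H x y + marginal1 G x * marginal2 G y / G x y - 1"
      unfolding is_bifree_max_conv_def by (metis less_irrefl)+
    have "marginal1 K x * marginal2 K y / K x y - 1 =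
        real n * (marginal1 G x * marginal2 G y / G x y - 1) + (marginal1 G x * marginal2 G y / G x y - 1)"
      unfolding K using step.IH[OF step.prems(1) pos(1)] by simp
    also have "\<dots> = real (Suc n) * (marginal1 G x * marginal2 G y / G x y - 1)"
      by (simp only: of_nat_Suc distrib_right mult_1_left add.commute)
    finally show ?case using pos by simp
  qed simp
  then show "G x y > 0"
    and "marginal1 F x * marginal2 F y / F x y - 1 = real n * (marginal1 G x * marginal2 G y / G x y - 1)"
    by auto
qed

text \<open>A convolution cannot vanish where both factors and both of its marginals are positive: there
\<open>H\<^sub>1H\<^sub>2/H \<ge> H\<^sub>1\<close> and \<open>G\<^sub>1G\<^sub>2/G \<ge> G\<^sub>1\<close>, so the prescribed value of the quotient for the convolution is at
least the first marginal \<open>H\<^sub>1 + G\<^sub>1 - 1 > 0\<close>, whereas division by zero would give the quotient zero.\<close>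

lemma bifree_max_power_pos:
  assumes "is_bifree_max_power G n F" "bivariate_cdf G"
    and "marginal1 F x > 0" "marginal2 F y > 0" "G x y > 0"
  shows "F x y > 0"
  using assms
proof (induction rule: is_bifree_max_power.induct)
  case (step n H K)
  have H: "bivariate_cdf H" by (rule bifree_max_power_bivariate_cdf[OF step.hyps(1) step.prems(1)])
  have K: "marginal1 K x = max (marginal1 H x + marginal1 G x - 1) 0"
    "marginal2 K y = max (marginal2 H y + marginal2 G y - 1) 0" and cK: "bivariate_cdf K"
    using step.hyps by (auto simp: is_bifree_max_conv_def)
  have HK: "marginal1 K x \<le> marginal1 H x" "marginal2 K y \<le> marginal2 H y"
    using K marginal1_le_1[OF step.prems(1), of x] marginal2_le_1[OF step.prems(1), of y]
      marginal1_nonneg[OF H, of x] marginal2_nonneg[OF H, of y] by auto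
  then have Hpos: "H x y > 0" using step.IH step.prems by simp
  have quot: "marginal1 L x \<le> marginal1 L x * marginal2 L y / L x y"
    if "bivariate_cdf L" "L x y > 0" for L
    using that bivariate_cdf_le_marginal2[OF that(1), of x y] marginal1_nonneg[OF that(1), of x]
    by (simp add: field_simps mult_left_mono)
  have "marginal1 K x * marginal2 K y / K x y =
      marginal1 H x * marginal2 H y / H x y + marginal1 G x * marginal2 G y / G x y - 1"
    using step.hyps(2) step.prems Hpos unfolding is_bifree_max_conv_def by metis
  also have "\<dots> \<ge> marginal1 H x + marginal1 G x - 1"
    using quot[OF H Hpos] quot[OF step.prems(1,4)] by simp
  finally have "marginal1 K x * marginal2 K y / K x y > 0"
    using K step.prems by (simp add: max_def split: if_splits)
  then have "K x y \<noteq> 0" by auto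
  then show ?case using bivariate_cdf_nonneg[OF cK, of x y] by simp
qed simp

text \<open>Where \<open>F\<close> is positive, the marginals of its roots and the additive quantity \<open>F\<^sub>1F\<^sub>2/F - 1\<close> determine the
roots \<open>G n\<close> completely, as rational functions of \<open>1/(n+1)\<close>. Hence \<open>1 - G n\<close> can be expanded to first
order, and the coefficient is the sum of the three additive quantities belonging to \<open>F\<close>.\<close>

lemma bifree_max_root_expansion:
  assumes F: "bivariate_cdf F" and G: "\<And>n. bivariate_cdf (G n)"
    and GF: "\<And>n. is_bifree_max_power (G n) (Suc n) F" and pos: "F x y > 0"
  shows "(\<lambda>n. real (Suc n) * (1 - G n x y)) \<longlonglongrightarrow>
      (1 - marginal1 F x) + (1 - marginal2 F y) + (marginal1 F x * marginal2 F y / F x y - 1)"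
    and "(\<lambda>n. G n x y) \<longlonglongrightarrow> 1"
    and "real (Suc n) * (1 - marginal1 (G n) x) = 1 - marginal1 F x"
proof -
  define a b c where "a = 1 - marginal1 F x" and "b = 1 - marginal2 F y"
    and "c = marginal1 F x * marginal2 F y / F x y - 1"
  have m: "marginal1 F x > 0" "marginal2 F y > 0"
    using bivariate_cdf_le_marginal1[OF F, of x y] bivariate_cdf_le_marginal2[OF F, of x y] pos by simp_all
  have ma: "real (Suc n) * (1 - marginal1 (G n) x) = a" for n
    using bifree_max_power_marginal1[OF GF[of n] G[of n], of x] m by (simp add: a_def max_def split: if_splits)
  then show "real (Suc n) * (1 - marginal1 (G n) x) = 1 - marginal1 F x" by (simp add: a_def)
  have mb: "real (Suc n) * (1 - marginal2 (G n) y) = b" for n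
    using bifree_max_power_marginal2[OF GF[of n] G[of n], of y] m by (simp add: b_def max_def split: if_splits)
  define h where "h n = inverse (real (Suc n))" for n
  have h: "real (Suc n) * h n = 1" for n by (simp add: h_def del: of_nat_Suc)
  have eq: "(1 + c * h n) * G n x y = (1 - a * h n) * (1 - b * h n)" and den: "1 + c * h n > 0" for n
  proof -
    have g: "marginal1 (G n) x = 1 - a * h n" "marginal2 (G n) y = 1 - b * h n"
      unfolding ma[of n, symmetric] mb[of n, symmetric] using h[of n] by (simp_all add: algebra_simps del: of_nat_Suc)
    have gp: "G n x y > 0" and r: "c = real (Suc n) * (marginal1 (G n) x * marginal2 (G n) y / G n x y - 1)"
      using bifree_max_power_ratio[OF GF[of n] G[of n] pos] by (simp_all add: c_def del: of_nat_Suc)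
    have "1 + c * h n = 1 + (real (Suc n) * h n) * (marginal1 (G n) x * marginal2 (G n) y / G n x y - 1)"
      unfolding r by (simp only: mult_ac)
    then have k: "1 + c * h n = marginal1 (G n) x * marginal2 (G n) y / G n x y"
      unfolding h by simp
    have "marginal1 (G n) x > 0" "marginal2 (G n) y > 0"
      using bivariate_cdf_le_marginal1[OF G, of n x y] bivariate_cdf_le_marginal2[OF G, of n x y] gp by simp_all
    with gp k g show "(1 + c * h n) * G n x y = (1 - a * h n) * (1 - b * h n)" "1 + c * h n > 0" by simp_all
  qed
  have hlim: "h \<longlonglongrightarrow> 0" unfolding h_def by (rule LIMSEQ_inverse_real_of_nat)
  have G_eq: "G n x y = (1 - a * h n) * (1 - b * h n) / (1 + c * h n)" for n
    using eq[of n] den[of n] by (simp add: field_simps)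
  have "(\<lambda>n. (1 - a * h n) * (1 - b * h n) / (1 + c * h n)) \<longlonglongrightarrow> (1 - a * 0) * (1 - b * 0) / (1 + c * 0)"
    by (intro tendsto_intros hlim) simp
  then show "(\<lambda>n. G n x y) \<longlonglongrightarrow> 1" unfolding G_eq by simp
  have "real (Suc n) * (1 - G n x y) = (a + b + c - a * b * h n) / (1 + c * h n)" for n
  proof -
    have "(1 + c * h n) * (1 - G n x y) = h n * (a + b + c - a * b * h n)"
      using eq[of n] by (simp add: algebra_simps)
    then have "(1 + c * h n) * (real (Suc n) * (1 - G n x y)) = (real (Suc n) * h n) * (a + b + c - a * b * h n)"
      by (simp only: mult_ac)
    then show ?thesis unfolding h using den[of n] by (simp add: field_simps del: of_nat_Suc)
  qed
  moreover have "(\<lambda>n. (a + b + c - a * b * h n) / (1 + c * h n)) \<longlonglongrightarrow> (a + b + c - a * b * 0) / (1 + c * 0)"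
    by (intro tendsto_intros hlim) simp
  ultimately show "(\<lambda>n. real (Suc n) * (1 - G n x y)) \<longlonglongrightarrow>
      (1 - marginal1 F x) + (1 - marginal2 F y) + (marginal1 F x * marginal2 F y / F x y - 1)"
    by (simp add: a_def[symmetric] b_def[symmetric] c_def[symmetric] del: of_nat_Suc)
qed

section \<open>Total positivity of bi-freely max-infinitely divisible functions\<close>

lemma bifree_max_inf_divisible_swap:
  assumes "bifree_max_inf_divisible F"
  shows "bifree_max_inf_divisible (\<lambda>x y. F y x)"
  unfolding bifree_max_inf_divisible_def
proof (intro allI impI)
  fix n :: nat
  assume "n \<ge> 1"
  then obtain G where G: "bivariate_cdf G" "is_bifree_max_power G n F"
    using assms by (auto simp: bifree_max_inf_divisible_def)
  show "\<exists>G. bivariate_cdf G \<and> is_bifree_max_power G n (\<lambda>x y. F y x)"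
    by (rule exI[of _ "\<lambda>x y. G y x"], rule conjI[OF bivariate_cdf_swap[OF G(1)] is_bifree_max_power_swap[OF G(2)]])
qed

lemma bifree_max_roots:
  assumes "bifree_max_inf_divisible F"
  shows "\<exists>G. \<forall>n. bivariate_cdf (G n) \<and> is_bifree_max_power (G n) (Suc n) F"
proof -
  from assms have "\<forall>n. \<exists>G. bivariate_cdf G \<and> is_bifree_max_power G (Suc n) F"
    by (auto simp: bifree_max_inf_divisible_def)
  then show ?thesis by (rule choice)
qed

text \<open>First-order form, as \<open>n\<close> grows, of the rectangle inequality for the roots on rectangles that are
unbounded above: the contributions of the marginals cancel and only \<open>F\<^sub>1F\<^sub>2/F\<close> remains.\<close>

lemma bifree_max_inf_divisible_ratio_mono:
  assumes F: "bivariate_cdf F" and div: "bifree_max_inf_divisible F"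
    and le: "a \<le> b" and pos_a: "F a y > 0"
  shows "marginal1 F a * marginal2 F y / F a y \<le> marginal1 F b * marginal2 F y / F b y" (is "?K a \<le> ?K b")
proof -
  have pos_b: "F b y > 0" using bivariate_cdf_mono1[OF F le, of y] pos_a by simp
  obtain G where G: "\<And>n. bivariate_cdf (G n)" and GF: "\<And>n. is_bifree_max_power (G n) (Suc n) F"
    using bifree_max_roots[OF div] by blast
  note lim = bifree_max_root_expansion(1)[OF F G GF] and marg = bifree_max_root_expansion(3)[OF F G GF]
  have le_n: "(1 - marginal1 F b) + real (Suc n) * (1 - G n a y) \<le>
      (1 - marginal1 F a) + real (Suc n) * (1 - G n b y)" for n
    unfolding marg[OF pos_a, of n, symmetric] marg[OF pos_b, of n, symmetric]
    using mult_left_mono[OF bivariate_cdf_rectangle_at_top[OF G le, of n y], of "real (Suc n)"]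
    by (simp add: algebra_simps)
  have "(1 - marginal1 F b) + ((1 - marginal1 F a) + (1 - marginal2 F y) + (?K a - 1)) \<le>
      (1 - marginal1 F a) + ((1 - marginal1 F b) + (1 - marginal2 F y) + (?K b - 1))"
    by (rule LIMSEQ_le[OF tendsto_add[OF tendsto_const lim[OF pos_a]] tendsto_add[OF tendsto_const lim[OF pos_b]]])
      (intro exI allI impI le_n)
  then show ?thesis by simp
qed

text \<open>In terms of \<open>K = F\<^sub>1F\<^sub>2/F\<close> the claim is that \<open>K a c * K b d \<le> K a d * K b c\<close>. To first order the rectangle
inequality for the roots gives the same inequality for sums in place of products. Since \<open>K\<close> is
nondecreasing in both arguments, \<open>K b d\<close> is the largest of the four values, and the inequality for sums then
implies the one for products.\<close>

lemma bifree_max_inf_divisible_TP2: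
  assumes F: "bivariate_cdf F" and div: "bifree_max_inf_divisible F"
    and le: "a \<le> b" "c \<le> d"
  shows "F b c * F a d \<le> F a c * F b d"
proof (cases "F b c > 0 \<and> F a d > 0")
  case False
  then have "F b c * F a d = 0"
    using bivariate_cdf_nonneg[OF F, of b c] bivariate_cdf_nonneg[OF F, of a d] by (smt (verit) mult_eq_0_iff)
  then show ?thesis using bivariate_cdf_nonneg[OF F] by (metis mult_nonneg_nonneg)
next
  case True
  then have pos: "F b c > 0" "F a d > 0" "F b d > 0"
    using bivariate_cdf_mono2[OF F le(2), of b] by auto
  obtain G where G: "\<And>n. bivariate_cdf (G n)" and GF: "\<And>n. is_bifree_max_power (G n) (Suc n) F"
    using bifree_max_roots[OF div] by blast
  note lim = bifree_max_root_expansion(1)[OF F G GF]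
  have m: "marginal1 F a > 0" "marginal1 F b > 0" "marginal2 F c > 0" "marginal2 F d > 0"
    using pos bivariate_cdf_le_marginal1[OF F, of a d] bivariate_cdf_le_marginal1[OF F, of b d]
      bivariate_cdf_le_marginal2[OF F, of b c] bivariate_cdf_le_marginal2[OF F, of b d] by simp_all
  \<comment> \<open>If \<open>F\<close> vanished at the lower left corner, then so would every root, but the roots tend
    to one at the other three corners, against the rectangle inequality.\<close>
  have pos_ac: "F a c > 0"
  proof (rule ccontr)
    assume "\<not> F a c > 0"
    then have "\<not> G n a c > 0" for n using bifree_max_power_pos[OF GF G m(1,3)] by blast
    then have "G n a c = 0" for n using bivariate_cdf_nonneg[OF G, of n a c] by (simp add: not_less antisym)
    then have "G n b c + G n a d - G n b d \<le> 0" for n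
      using bivariate_cdf_rectangle[OF G le, of n] by simp
    moreover have "(\<lambda>n. G n b c + G n a d - G n b d) \<longlonglongrightarrow> 1 + 1 - 1"
      by (intro tendsto_intros bifree_max_root_expansion(2)[OF F G GF] pos)
    ultimately have "1 + 1 - 1 \<le> (0::real)" by (intro LIMSEQ_le_const2) auto
    then show False by simp
  qed
  define K where "K x y = marginal1 F x * marginal2 F y / F x y" for x y
  have K_rect: "K a c + K b d \<le> K a d + K b c"
  proof -
    let ?L = "\<lambda>n x y. real (Suc n) * (1 - G n x y)"
    have le_n: "?L n a c + ?L n b d \<le> ?L n a d + ?L n b c" for n
      using mult_left_mono[OF bivariate_cdf_rectangle[OF G le, of n], of "real (Suc n)"]
      by (simp add: algebra_simps)
    have "(1 - marginal1 F a) + (1 - marginal2 F c) + (K a c - 1) +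
        ((1 - marginal1 F b) + (1 - marginal2 F d) + (K b d - 1)) \<le>
        (1 - marginal1 F a) + (1 - marginal2 F d) + (K a d - 1) +
        ((1 - marginal1 F b) + (1 - marginal2 F c) + (K b c - 1))"
      unfolding K_def
      by (rule LIMSEQ_le[OF tendsto_add[OF lim[OF pos_ac] lim[OF pos(3)]] tendsto_add[OF lim[OF pos(2)] lim[OF pos(1)]]])
        (intro exI allI impI le_n)
    then show ?thesis by simp
  qed
  have K_mono: "K a d \<le> K b d" "K b c \<le> K b d"
    using bifree_max_inf_divisible_ratio_mono[OF F div le(1), of d]
      bifree_max_inf_divisible_ratio_mono[OF bivariate_cdf_swap[OF F] bifree_max_inf_divisible_swap[OF div] le(2), of b]
      pos by (simp_all add: K_def marginal_swap[of F] mult.commute)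
  have "0 \<le> (K b d - K a d) * (K b d - K b c)" using K_mono by simp
  moreover have "K a c * K b d \<le> (K a d + K b c - K b d) * K b d"
    using K_rect pos m by (intro mult_right_mono) (auto simp: K_def)
  ultimately have "K a c * K b d \<le> K a d * K b c" by (simp add: algebra_simps)
  define p where "p = marginal1 F a * marginal1 F b * marginal2 F c * marginal2 F d"
  have p: "p > 0" using m by (simp add: p_def)
  have "K a c * K b d = p / (F a c * F b d)" "K a d * K b c = p / (F b c * F a d)"
    by (simp_all add: K_def p_def mult_ac)
  with \<open>K a c * K b d \<le> K a d * K b c\<close> have "p / (F a c * F b d) \<le> p / (F b c * F a d)" by simp
  then show ?thesis using p pos pos_ac by (simp add: field_simps)
qed

section \<open>Powers of totally positive distribution functions\<close>

text \<open>With \<open>P = p powr t\<close> and \<open>Q\<close>, \<open>R\<close>, \<open>S\<close> defined likewise, total positivity survives the power, \<open>Q * R \<le> S * P\<close>, and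
monotonicity gives \<open>(P - Q) * (P - R) \<ge> 0\<close>. Adding the two and cancelling \<open>P\<close> yields the claim.\<close>

lemma rectangle_powr_of_TP2:
  fixes s q r p t :: real
  assumes "0 \<le> s" "s \<le> q" "s \<le> r" "q \<le> p" "r \<le> p" and TP2: "q * r \<le> s * p" and t: "0 \<le> t"
  shows "q powr t + r powr t \<le> s powr t + p powr t"
proof (cases "p = 0")
  case True
  with assms have "q = 0" "r = 0" "s = 0" by linarith+
  with True show ?thesis by simp
next
  case False
  then have p: "p powr t > 0" by simp
  have "0 \<le> (p powr t - q powr t) * (p powr t - r powr t)"
    using assms by (intro mult_nonneg_nonneg) (auto intro: powr_mono2)
  moreover have "q powr t * r powr t \<le> s powr t * p powr t"
    using powr_mono2[OF t _ TP2] assms by (simp add: powr_mult)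
  ultimately have "(q powr t + r powr t) * p powr t \<le> (s powr t + p powr t) * p powr t"
    by (simp add: algebra_simps)
  then show ?thesis using p by simp
qed

lemma bivariate_cdf_powr_of_TP2:
  assumes F: "bivariate_cdf F" and t: "0 < t"
    and TP2: "\<And>a b c d. a \<le> b \<Longrightarrow> c \<le> d \<Longrightarrow> F b c * F a d \<le> F a c * F b d"
  shows "bivariate_cdf (\<lambda>x y. F x y powr t)"
proof -
  have lim: "((\<lambda>z. f z powr t) \<longlongrightarrow> l powr t) A" if "(f \<longlongrightarrow> l) A" "\<And>z. 0 \<le> f z" for f l and A :: "real filter"
    using that t by (intro tendsto_powr') auto
  have lim0: "((\<lambda>z. f z powr t) \<longlongrightarrow> 0) A" if "(f \<longlongrightarrow> 0) A" "\<And>z. 0 \<le> f z" for f and A :: "real filter"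
    using lim[OF that] t by simp
  have lim1: "((\<lambda>z. f z powr t) \<longlongrightarrow> 1) A" if "(f \<longlongrightarrow> 1) A" "\<And>z. 0 \<le> f z" for f and A :: "real filter"
    using lim[OF that] t by simp
  note nn = bivariate_cdf_nonneg[OF F]
  show ?thesis
  proof (rule bivariate_cdfI)
    show "F b c powr t + F a d powr t \<le> F a c powr t + F b d powr t" if "a \<le> b" "c \<le> d" for a b c d
      using that t
      by (intro rectangle_powr_of_TP2 TP2 nn bivariate_cdf_mono1[OF F] bivariate_cdf_mono2[OF F]) auto
    show "continuous (at_right x) (\<lambda>x. F x y powr t)" for x y
      using lim[OF bivariate_cdf_right_cont1[OF F, unfolded continuous_within] nn] by (simp add: continuous_within)
    show "continuous (at_right y) (\<lambda>y. F x y powr t)" for x y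
      using lim[OF bivariate_cdf_right_cont2[OF F, unfolded continuous_within] nn] by (simp add: continuous_within)
    show "((\<lambda>x. F x y powr t) \<longlongrightarrow> 0) at_bot" for y by (rule lim0[OF bivariate_cdf_at_bot1[OF F] nn])
    show "((\<lambda>y. F x y powr t) \<longlongrightarrow> 0) at_bot" for x by (rule lim0[OF bivariate_cdf_at_bot2[OF F] nn])
    show "((\<lambda>x. F x y powr t) \<longlongrightarrow> marginal2 F y powr t) at_top" for y
      by (rule lim[OF bivariate_cdf_at_top1[OF F] nn])
    show "((\<lambda>y. F x y powr t) \<longlongrightarrow> marginal1 F x powr t) at_top" for x
      by (rule lim[OF bivariate_cdf_at_top2[OF F] nn])
    show "continuous (at_right x) (\<lambda>x. marginal1 F x powr t)" for x
      using lim[OF marginal1_right_cont[OF F, unfolded continuous_within] marginal1_nonneg[OF F]]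
      by (simp add: continuous_within)
    show "((\<lambda>x. marginal1 F x powr t) \<longlongrightarrow> 0) at_bot"
      by (rule lim0[OF marginal1_at_bot[OF F] marginal1_nonneg[OF F]])
    show "((\<lambda>x. marginal1 F x powr t) \<longlongrightarrow> 1) at_top"
      by (rule lim1[OF marginal1_at_top[OF F] marginal1_nonneg[OF F]])
  qed
qed

theorem theorem7p1:
  fixes F :: "real \<Rightarrow> real \<Rightarrow> real"
  assumes "bivariate_cdf F"
    and "bifree_max_inf_divisible F"
  shows "max_inf_divisible F"
  unfolding max_inf_divisible_def
  using bivariate_cdf_powr_of_TP2[OF assms(1)] bifree_max_inf_divisible_TP2[OF assms] by simp

end
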